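(* Let $R>0$ and let $a(z),b(z),c(z)$ be complex analytic functions for $|z|<R$. Consider the equation $$L(u):=z^3u'''+z^2a(z)u''+zb(z)u'+c(z)u=0 .\qquad( * )$$ Let $r_1,r_2,r_3$ be the roots of the indicial polynomial $$q(r)=r(r-1)(r-2)+r(r-1)a(0)+rb(0)+c(0),$$ with $\mathrm{Re}(r_1)\ge \mathrm{Re}(r_2)\ge \mathrm{Re}(r_3)$. Then for $0<|z|<R$ there is a solution $\varphi_1$ of $( * )$ given by $$\varphi_1(z)=z^{r_1}\sum_{n=0}^\infty d_nz^n,\qquad d_0=1,$$ where the series converges for $|z|<R$. Moreover, if $r_1-r_2\notin\mathbb Z_0^+$, $r_1-r_3\notin\mathbb Z_0^+$ and $r_2-r_3\notin\mathbb Z_0^+$, then there exist two other linearly independent solutions $\varphi_2,\varphi_3$ defined in $0<|z|<R$, given by $$\varphi_2(z)=z^{r_2}\sum_{n=0}^\infty\tilde d_nz^n,\quad \tilde d_0=1,\qquad \varphi_3(z)=z^{r_3}\sum_{n=0}^\infty\hat d_nz^n,\quad \hat d_0=1,$$ where the series converge for $|z|<R$. The coefficients $d_n,\tilde d_n,\hat d_n$ can be obtained by substituting the solutions in equation $( * )$.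
   Context: $\mathbb Z_0^+$ denotes the set of non-negative integers. The power $z^{r}$ is in general multivalued and is understood through (local) branches of $z^r=\exp(r\log z)$ in $0<|z|<R$. *)

theory Defs
  imports "HOL-Complex_Analysis.Complex_Analysis"
begin

definition indicial_poly ::
  "(complex \<Rightarrow> complex) \<Rightarrow> (complex \<Rightarrow> complex) \<Rightarrow> (complex \<Rightarrow> complex) \<Rightarrow> complex poly" where
  "indicial_poly a b c =
     [:0, 1:] * [:-1, 1:] * [:-2, 1:] + smult (a 0) ([:0, 1:] * [:-1, 1:])
     + smult (b 0) [:0, 1:] + [:c 0:]"

definition euler_op ::
  "(complex \<Rightarrow> complex) \<Rightarrow> (complex \<Rightarrow> complex) \<Rightarrow> (complex \<Rightarrow> complex) \<Rightarrow>
   (complex \<Rightarrow> complex) \<Rightarrow> complex \<Rightarrow> complex" where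
  "euler_op a b c u z =
     z ^ 3 * (deriv ^^ 3) u z + z ^ 2 * a z * (deriv ^^ 2) u z + z * b z * deriv u z + c z * u z"

definition solves_euler_on ::
  "(complex \<Rightarrow> complex) \<Rightarrow> (complex \<Rightarrow> complex) \<Rightarrow> (complex \<Rightarrow> complex) \<Rightarrow>
   complex set \<Rightarrow> (complex \<Rightarrow> complex) \<Rightarrow> bool" where
  "solves_euler_on a b c U u \<longleftrightarrow> u holomorphic_on U \<and> (\<forall>z\<in>U. euler_op a b c u z = 0)"

(* A multivalued expression in the punctured disc is handled through all its local branches:
   every branch l of the logarithm on an open part U gives the branch exp (r * l z) of z^r.
   The same l is used for all exponents. *)
definition log_branch_in :: "real \<Rightarrow> complex set \<Rightarrow> (complex \<Rightarrow> complex) \<Rightarrow> bool" where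
  "log_branch_in R U l \<longleftrightarrow>
     open U \<and> U \<subseteq> ball 0 R - {0} \<and> l holomorphic_on U \<and> (\<forall>z\<in>U. exp (l z) = z)"

definition frob_fun ::
  "(complex \<Rightarrow> complex) \<Rightarrow> complex \<Rightarrow> (nat \<Rightarrow> complex) \<Rightarrow> complex \<Rightarrow> complex" where
  "frob_fun l r d z = exp (r * l z) * (\<Sum>n. d n * z ^ n)"

definition frob_solution ::
  "real \<Rightarrow> (complex \<Rightarrow> complex) \<Rightarrow> (complex \<Rightarrow> complex) \<Rightarrow> (complex \<Rightarrow> complex) \<Rightarrow>
   complex \<Rightarrow> (nat \<Rightarrow> complex) \<Rightarrow> bool" where
  "frob_solution R a b c r d \<longleftrightarrow>
     d 0 = 1 \<and>
     (\<forall>z\<in>ball 0 R. summable (\<lambda>n. d n * z ^ n)) \<and>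
     (\<forall>U l. log_branch_in R U l \<longrightarrow> solves_euler_on a b c U (frob_fun l r d))"

(* For a power series F, the derivative of z^s F is z^(s-1) (s F + z F'). *)
definition fps_pow_deriv :: "complex \<Rightarrow> complex fps \<Rightarrow> complex fps" where
  "fps_pow_deriv s F = fps_const s * F + fps_X * fps_deriv F"

(* The formal power series z^(-r) L(z^r F), where L is the operator of the equation;
   its n-th coefficient is the coefficient of z^(r+n) after substituting z^r F. *)
definition fps_euler_op ::
  "(complex \<Rightarrow> complex) \<Rightarrow> (complex \<Rightarrow> complex) \<Rightarrow> (complex \<Rightarrow> complex) \<Rightarrow>
   complex \<Rightarrow> complex fps \<Rightarrow> complex fps" where
  "fps_euler_op a b c r F =
     fps_pow_deriv (r - 2) (fps_pow_deriv (r - 1) (fps_pow_deriv r F))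
     + fps_expansion a 0 * fps_pow_deriv (r - 1) (fps_pow_deriv r F)
     + fps_expansion b 0 * fps_pow_deriv r F
     + fps_expansion c 0 * F"

(* Substituting z^r (\<Sum>n. e n z^n) with e 0 = 1 into the equation and comparing
   coefficients has d as its one and only solution. *)
definition obtained_by_substitution ::
  "(complex \<Rightarrow> complex) \<Rightarrow> (complex \<Rightarrow> complex) \<Rightarrow> (complex \<Rightarrow> complex) \<Rightarrow>
   complex \<Rightarrow> (nat \<Rightarrow> complex) \<Rightarrow> bool" where
  "obtained_by_substitution a b c r d \<longleftrightarrow>
     (\<forall>e. e 0 = 1 \<and> fps_euler_op a b c r (Abs_fps e) = 0 \<longleftrightarrow> e = d)"

definition lin_indep3_on ::
  "complex set \<Rightarrow> (complex \<Rightarrow> complex) \<Rightarrow> (complex \<Rightarrow> complex) \<Rightarrow> (complex \<Rightarrow> complex) \<Rightarrow> bool" where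
  "lin_indep3_on U f g h \<longleftrightarrow>
     (\<forall>\<alpha> \<beta> \<gamma> :: complex.
        (\<forall>z\<in>U. \<alpha> * f z + \<beta> * g z + \<gamma> * h z = 0) \<longrightarrow> \<alpha> = 0 \<and> \<beta> = 0 \<and> \<gamma> = 0)"

end

theory Submission
  imports Defs "HOL-Computational_Algebra.Fundamental_Theorem_Algebra"
begin

text \<open>Substituting z^r F(z) with F = sum d_n z^n into the equation and comparing coefficients
  gives q(r+n) d_n = - sum_{k<n} w(n-k,k) d_k, where q is the indicial polynomial
  (\<open>fps_euler_op_nth\<close>). If q(r) = 0 and no r+n with n > 0 is a root, exactly one
  sequence with d_0 = 1 satisfies this (\<open>frob_coeff_unique\<close>). For r1 the real part of
  r1+n exceeds that of every root; for r2 and r3 the conditions on the differences exclude the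
  remaining coincidences.

  Convergence: q(r+n) grows cubically in n, whereas by Cauchy estimates w(n-k,k) is at most a
  constant times n^2 rho^(k-n) for large n, for each 0 < rho < R. Hence d_n t^n stays bounded for 0
  < t < R (\<open>frob_recurrence_bounded\<close>, \<open>fps_conv_radius_frob\<close>), and
  differentiation on a branch of the logarithm turns the formal solution into a genuine one
  (\<open>solves_euler_on_frob_fun\<close>).

  Independence is a monodromy argument: a turn around the origin multiplies z^r F by exp(2 pi i r).
  These factors are distinct for the three roots, since no two differ by an integer, so a linear
  relation continued along zero, one and two turns is a Vandermonde system that kills each summand
  (\<open>frob_funs_lin_indep\<close>).\<close>

section \<open>The recurrence for the coefficients and its unique solution\<close>

lemma fps_pow_deriv_nth [simp]: "fps_pow_deriv s F $ n = (s + of_nat n) * F $ n"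
  by (cases n) (simp_all add: fps_pow_deriv_def algebra_simps)

text \<open>The factor with which d_k enters the coefficient of z^(r+k+j), for j > 0. The
  third-order term has constant coefficient 1, so it acts only on the diagonal j = 0 and is absent
  here.\<close>

definition frob_weight ::
  "complex fps \<Rightarrow> complex fps \<Rightarrow> complex fps \<Rightarrow> complex \<Rightarrow> nat \<Rightarrow> nat \<Rightarrow> complex" where
  "frob_weight A B C r j k =
     A $ j * ((r + of_nat k) * (r + of_nat k - 1)) + B $ j * (r + of_nat k) + C $ j"

abbreviation euler_weight where
  "euler_weight a b c \<equiv> frob_weight (fps_expansion a 0) (fps_expansion b 0) (fps_expansion c 0)"

lemma fps_mult_nth_lessThan:
  fixes F G :: "complex fps"
  shows "(F * G) $ n = (\<Sum>k<n. F $ (n - k) * G $ k) + F $ 0 * G $ n"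
proof -
  have "(F * G) $ n = (G * F) $ n" by (simp add: mult.commute)
  also have "\<dots> = (\<Sum>k\<le>n. F $ (n - k) * G $ k)"
    unfolding fps_mult_nth atLeast0AtMost by (simp add: mult.commute)
  also have "\<dots> = (\<Sum>k<n. F $ (n - k) * G $ k) + F $ 0 * G $ n"
    by (simp add: lessThan_Suc_atMost [symmetric])
  finally show ?thesis .
qed

text \<open>In each product with \<open>A\<close>, \<open>B\<close>, \<open>C\<close> the term k = n
  carries the value at 0 of \<open>a\<close>, \<open>b\<close> or \<open>c\<close>; together with
  the third-order term these make up the indicial polynomial at r+n.\<close>

lemma fps_euler_op_nth:
  "fps_euler_op a b c r F $ n =
     poly (indicial_poly a b c) (r + of_nat n) * F $ n
     + (\<Sum>k<n. euler_weight a b c r (n - k) k * F $ k)"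
proof -
  define A B C where "A = fps_expansion a 0" and "B = fps_expansion b 0" and "C = fps_expansion c 0"
  have 0: "A $ 0 = a 0" "B $ 0 = b 0" "C $ 0 = c 0"
    by (simp_all add: A_def B_def C_def fps_expansion_def)
  have w: "(\<Sum>k<n. frob_weight A B C r (n - k) k * F $ k) =
      (\<Sum>k<n. A $ (n - k) * ((r - 1 + of_nat k) * ((r + of_nat k) * F $ k)))
      + (\<Sum>k<n. B $ (n - k) * ((r + of_nat k) * F $ k)) + (\<Sum>k<n. C $ (n - k) * F $ k)"
    unfolding sum.distrib [symmetric] by (simp add: frob_weight_def algebra_simps)
  show ?thesis
    unfolding fps_euler_op_def A_def [symmetric] B_def [symmetric] C_def [symmetric] w
      fps_add_nth fps_mult_nth_lessThan fps_pow_deriv_nth 0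
    by (simp add: indicial_poly_def algebra_simps)
qed

text \<open>The multiset of roots fixes a polynomial only up to its leading coefficient, so the
  proof expands the polynomial to see that it is monic.\<close>

lemma indicial_poly_factor:
  assumes "proots (indicial_poly a b c) = {#r1, r2, r3#}"
  shows "poly (indicial_poly a b c) x = (x - r1) * (x - r2) * (x - r3)"
proof -
  have *: "indicial_poly a b c = [:c 0, 2 - a 0 + b 0, a 0 - 3, 1:]"
    by (simp add: indicial_poly_def)
  have "indicial_poly a b c = [:-r1, 1:] * ([:-r2, 1:] * [:-r3, 1:])"
    using complex_poly_decompose_multiset [of "indicial_poly a b c"] unfolding assms
    by (simp add: * del: mult_pCons_left mult_pCons_right)
  thus ?thesis by (simp add: algebra_simps)
qed

fun frob_coeff :: "(nat \<Rightarrow> complex) \<Rightarrow> (nat \<Rightarrow> nat \<Rightarrow> complex) \<Rightarrow> nat \<Rightarrow> complex" where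
  "frob_coeff Q w n =
     (if n = 0 then 1 else - (\<Sum>k<n. w (n - k) k * frob_coeff Q w k) / Q n)"

declare frob_coeff.simps [simp del]

lemma frob_coeff_0 [simp]: "frob_coeff Q w 0 = 1"
  by (simp add: frob_coeff.simps)

text \<open>Since \<open>Q 0 = 0\<close>, the equation for n = 0 is vacuous and leaves the
  normalisation free; every later one can be solved for \<open>e n\<close>. The equivalence yields
  existence and uniqueness at once.\<close>

lemma frob_coeff_unique:
  assumes "Q 0 = 0" and "\<And>n. n > 0 \<Longrightarrow> Q n \<noteq> 0"
  shows "e 0 = 1 \<and> (\<forall>n. Q n * e n + (\<Sum>k<n. w (n - k) k * e k) = 0) \<longleftrightarrow> e = frob_coeff Q w"
proof safe
  assume e: "e 0 = 1" "\<forall>n. Q n * e n + (\<Sum>k<n. w (n - k) k * e k) = 0"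
  have "e n = frob_coeff Q w n" for n
  proof (induction n rule: less_induct)
    case (less n)
    show ?case
    proof (cases "n = 0")
      case False
      have "Q n * e n = - (\<Sum>k<n. w (n - k) k * e k)"
        using e(2) by (simp add: eq_neg_iff_add_eq_0)
      also have "(\<Sum>k<n. w (n - k) k * e k) = (\<Sum>k<n. w (n - k) k * frob_coeff Q w k)"
        using less by simp
      finally show ?thesis
        using False assms by (subst frob_coeff.simps) (simp add: field_simps)
    qed (simp add: e)
  qed
  thus "e = frob_coeff Q w" by blast
next
  fix n
  show "Q n * frob_coeff Q w n + (\<Sum>k<n. w (n - k) k * frob_coeff Q w k) = 0"
    using assms by (cases "n = 0") (simp_all add: frob_coeff.simps [of _ _ n])
qed simp

section \<open>Convergence of the formal solution\<close>

lemma fps_nth_bound: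
  fixes F :: "complex fps"
  assumes "ereal \<rho> < fps_conv_radius F" and "\<rho> > 0"
  obtains M where "M \<ge> 0" and "\<And>n. norm (F $ n) * \<rho> ^ n \<le> M"
proof -
  have "summable (\<lambda>n. F $ n * of_real \<rho> ^ n)"
    using assms by (intro summable_fps) simp
  hence "Bseq (\<lambda>n. F $ n * of_real \<rho> ^ n)"
    using convergentI summable_LIMSEQ_zero convergent_imp_Bseq by blast
  then obtain M where "M > 0" "\<And>n. norm (F $ n * of_real \<rho> ^ n) \<le> M"
    by (auto simp: Bseq_def)
  thus thesis using that [of M] assms by (simp add: norm_mult norm_power)
qed

lemma frob_weight_bound:
  assumes "ereal \<rho> < fps_conv_radius A" "ereal \<rho> < fps_conv_radius B" "ereal \<rho> < fps_conv_radius C"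
    and "\<rho> > 0"
  obtains M where "M \<ge> 0"
    and "\<And>j k n. k < n \<Longrightarrow> norm r + 1 \<le> real n \<Longrightarrow>
           norm (frob_weight A B C r j k) * \<rho> ^ j \<le> M * real n ^ 2"
proof -
  obtain M1 M2 M3 where M: "M1 \<ge> 0" "\<And>n. norm (A $ n) * \<rho> ^ n \<le> M1"
      "M2 \<ge> 0" "\<And>n. norm (B $ n) * \<rho> ^ n \<le> M2"
      "M3 \<ge> 0" "\<And>n. norm (C $ n) * \<rho> ^ n \<le> M3"
    using fps_nth_bound [OF assms(1,4)] fps_nth_bound [OF assms(2,4)] fps_nth_bound [OF assms(3,4)]
    by metis
  show thesis
  \<comment> \<open>For k < n and n >= |r| + 1 both |r+k| and |r+k-1| are at most 2n: the quadratic
    term costs 4 n^2, the linear one 2n <= 2 n^2, the constant one 1 <= n^2.\<close>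
  proof (rule that [of "4 * M1 + 2 * M2 + M3"])
    fix j k n :: nat
    assume kn: "k < n" and n: "norm r + 1 \<le> real n"
    have k: "real k + 1 \<le> real n" using kn by linarith
    have n1: "real n \<ge> 1" using n norm_ge_zero [of r] by linarith
    have s: "norm (r + of_nat k) \<le> 2 * real n"
      using norm_triangle_ineq [of r "of_nat k"] n k unfolding norm_of_nat by linarith
    have s1: "norm (r + of_nat k - 1) \<le> 2 * real n"
      using norm_triangle_ineq4 [of "r + of_nat k" 1] norm_triangle_ineq [of r "of_nat k"] n k
      unfolding norm_of_nat norm_one by linarith
    have n2: "real n \<le> real n ^ 2" "1 \<le> real n ^ 2"
      using n1 by (auto intro: self_le_power)
    define a b c where "a = norm (A $ j) * \<rho> ^ j" "b = norm (B $ j) * \<rho> ^ j" "c = norm (C $ j) * \<rho> ^ j"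
    have abc: "0 \<le> a" "0 \<le> b" "0 \<le> c" "a \<le> M1" "b \<le> M2" "c \<le> M3"
      using M \<open>\<rho> > 0\<close> by (auto simp: a_b_c_def)
    have "norm (frob_weight A B C r j k) \<le>
        norm (A $ j) * (norm (r + of_nat k) * norm (r + of_nat k - 1))
        + norm (B $ j) * norm (r + of_nat k) + norm (C $ j)"
      unfolding frob_weight_def by (simp only: norm_mult [symmetric]) (intro norm_triangle_mono order_refl)
    hence "norm (frob_weight A B C r j k) * \<rho> ^ j \<le>
        (norm (A $ j) * (norm (r + of_nat k) * norm (r + of_nat k - 1))
        + norm (B $ j) * norm (r + of_nat k) + norm (C $ j)) * \<rho> ^ j"
      using \<open>\<rho> > 0\<close> by (intro mult_right_mono) auto
    also have "\<dots> = a * (norm (r + of_nat k) * norm (r + of_nat k - 1)) + b * norm (r + of_nat k) + c"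
      by (simp add: a_b_c_def algebra_simps)
    also have "\<dots> \<le> M1 * (2 * real n * (2 * real n)) + M2 * (2 * real n) + M3 * 1"
      using abc s s1 M(1,3,5) by (intro add_mono mult_mono) auto
    also have "\<dots> \<le> M1 * (4 * real n ^ 2) + M2 * (2 * real n ^ 2) + M3 * real n ^ 2"
      using n2 M(1,3,5) by (intro add_mono mult_left_mono) (auto simp: power2_eq_square)
    finally show "norm (frob_weight A B C r j k) * \<rho> ^ j \<le> (4 * M1 + 2 * M2 + M3) * real n ^ 2"
      by (simp add: algebra_simps)
  qed (use M in simp)
qed

lemma sum_power_diff_le:
  fixes \<theta> :: real
  assumes "0 \<le> \<theta>" "\<theta> < 1"
  shows "(\<Sum>k<n. \<theta> ^ (n - k)) \<le> 1 / (1 - \<theta>)"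
proof -
  have "(\<Sum>k<n. \<theta> ^ (n - k)) \<le> (\<Sum>k<n. \<theta> ^ (n - Suc k))"
    using assms by (intro sum_mono power_decreasing) auto
  also have "\<dots> = (\<Sum>k<n. \<theta> ^ k)" by (rule sum.nat_diff_reindex)
  also have "\<dots> \<le> (\<Sum>k. \<theta> ^ k)"
    using assms by (intro sum_le_suminf summable_geometric) auto
  also have "\<dots> = 1 / (1 - \<theta>)"
    using assms by (intro suminf_geometric) auto
  finally show ?thesis .
qed

text \<open>The indicial factor grows like \<open>n ^ 3\<close> but the weights only like \<open>n ^ 2\<close>, so for large \<open>n\<close> the
  recurrence cannot increase the maximum of \<open>norm (d k) * t ^ k\<close> over \<open>k < n\<close>.\<close>
lemma frob_recurrence_bounded:
  fixes d Q :: "nat \<Rightarrow> complex" and \<rho> t K M :: real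
  assumes rec: "\<And>n. n > 0 \<Longrightarrow> Q n * d n = - (\<Sum>k<n. w (n - k) k * d k)"
    and Q: "eventually (\<lambda>n. norm (Q n) \<ge> K * real n ^ 3) sequentially" and K: "K > 0"
    and w: "eventually (\<lambda>n. \<forall>k<n. \<forall>j. norm (w j k) * \<rho> ^ j \<le> M * real n ^ 2) sequentially"
    and M: "M \<ge> 0" and t: "0 < t" "t < \<rho>"
  obtains B where "\<And>n. norm (d n) * t ^ n \<le> B"
proof -
  \<comment> \<open>The weights decay like rho^-(n-k), while the bound on \<open>d k\<close> loses
    only t^-k; their quotient is geometric with this ratio below 1.\<close>
  define \<theta> where "\<theta> = t / \<rho>"
  have \<theta>: "0 < \<theta>" "\<theta> < 1" using t by (auto simp: \<theta>_def)
  \<comment> \<open>Beyond this threshold M n^2 / (1 - theta) <= K n^3, which is what the induction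
    step consumes.\<close>
  have "eventually (\<lambda>n. real n \<ge> M / (K * (1 - \<theta>))) sequentially"
    by real_asymp
  hence "eventually (\<lambda>n. n > 0 \<and> norm (Q n) \<ge> K * real n ^ 3 \<and> real n \<ge> M / (K * (1 - \<theta>)) \<and>
      (\<forall>k<n. \<forall>j. norm (w j k) * \<rho> ^ j \<le> M * real n ^ 2)) sequentially"
    using Q w eventually_gt_at_top [of 0] by eventually_elim blast
  then obtain N where N: "\<And>n. n \<ge> N \<Longrightarrow> n > 0 \<and> norm (Q n) \<ge> K * real n ^ 3 \<and>
      real n \<ge> M / (K * (1 - \<theta>)) \<and> (\<forall>k<n. \<forall>j. norm (w j k) * \<rho> ^ j \<le> M * real n ^ 2)"
    unfolding eventually_sequentially by blast
  \<comment> \<open>A sum of nonnegative terms dominates each of them, so it serves in place of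
    their maximum.\<close>
  define B where "B = (\<Sum>k<N. norm (d k) * t ^ k)"
  have B0: "B \<ge> 0" using t by (auto simp: B_def intro: sum_nonneg)
  have "norm (d n) * t ^ n \<le> B" for n
  proof (induction n rule: less_induct)
    case (less n)
    show ?case
    proof (cases "n < N")
      case True
      thus ?thesis unfolding B_def
        using t by (intro member_le_sum [of n _ "\<lambda>k. norm (d k) * t ^ k"]) auto
    next
      case False
      hence n: "n > 0" "norm (Q n) \<ge> K * real n ^ 3" "real n \<ge> M / (K * (1 - \<theta>))"
        and wn: "\<And>k j. k < n \<Longrightarrow> norm (w j k) * \<rho> ^ j \<le> M * real n ^ 2"
        using N [of n] by auto
      have "norm (Q n) * (norm (d n) * t ^ n) = norm (\<Sum>k<n. w (n - k) k * d k) * t ^ n"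
        using rec [OF n(1)] by (metis mult.assoc norm_minus_cancel norm_mult)
      also have "\<dots> \<le> (\<Sum>k<n. norm (w (n - k) k * d k)) * t ^ n"
        using t by (intro mult_right_mono norm_sum) auto
      also have "\<dots> = (\<Sum>k<n. (norm (w (n - k) k) * \<rho> ^ (n - k)) * (\<theta> ^ (n - k) * (norm (d k) * t ^ k)))"
        unfolding sum_distrib_right
      proof (rule sum.cong)
        fix k assume "k \<in> {..<n}"
        hence "t ^ n = t ^ (n - k) * t ^ k" by (simp flip: power_add)
        also have "t ^ (n - k) = \<rho> ^ (n - k) * \<theta> ^ (n - k)"
          using t by (simp add: \<theta>_def power_divide)
        finally show "norm (w (n - k) k * d k) * t ^ n =
            (norm (w (n - k) k) * \<rho> ^ (n - k)) * (\<theta> ^ (n - k) * (norm (d k) * t ^ k))"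
          by (simp add: norm_mult mult_ac)
      qed simp
      also have "\<dots> \<le> (\<Sum>k<n. (M * real n ^ 2) * (\<theta> ^ (n - k) * B))"
        using wn less t \<theta> M by (intro sum_mono mult_mono [of "_ * _"] mult_left_mono) auto
      also have "\<dots> = M * real n ^ 2 * B * (\<Sum>k<n. \<theta> ^ (n - k))"
        by (simp add: sum_distrib_left mult_ac)
      also have "\<dots> \<le> M * real n ^ 2 * B * (1 / (1 - \<theta>))"
        using \<theta> M B0 by (intro mult_left_mono sum_power_diff_le) auto
      also have "\<dots> = (M / (K * (1 - \<theta>))) * (K * real n ^ 2 * B)"
        using K \<theta> by (simp add: field_simps)
      also have "\<dots> \<le> real n * (K * real n ^ 2 * B)"
        using n K B0 by (intro mult_right_mono) auto
      also have "\<dots> = K * real n ^ 3 * B" by (simp add: power2_eq_square power3_eq_cube)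
      also have "\<dots> \<le> norm (Q n) * B" using n B0 by (intro mult_right_mono) auto
      finally have "norm (Q n) * (norm (d n) * t ^ n) \<le> norm (Q n) * B" .
      moreover have "norm (Q n) > 0"
        using n K by (intro less_le_trans [OF _ n(2)]) auto
      ultimately show ?thesis by simp
    qed
  qed
  thus thesis by (rule that)
qed

text \<open>Each of the three factors is eventually at least n/2 in modulus.\<close>

lemma cubic_eventually_ge:
  fixes r r1 r2 r3 :: complex
  shows "eventually (\<lambda>n. norm ((r + of_nat n - r1) * (r + of_nat n - r2) * (r + of_nat n - r3))
           \<ge> 1/8 * real n ^ 3) sequentially"
proof -
  have *: "eventually (\<lambda>n. norm (r + of_nat n - s) \<ge> real n / 2) sequentially" for s
  proof -
    have "eventually (\<lambda>n. real n / 2 \<ge> norm (r - s)) sequentially" by real_asymp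
    thus ?thesis
    proof eventually_elim
      case (elim n)
      have "norm (of_nat n :: complex) \<le> norm (r + of_nat n - s) + norm (r - s)"
        using norm_triangle_ineq4 [of "r + of_nat n - s" "r - s"] by simp
      thus ?case using elim unfolding norm_of_nat by linarith
    qed
  qed
  show ?thesis
    using * [of r1] * [of r2] * [of r3]
  proof eventually_elim
    case (elim n)
    have "1/8 * real n ^ 3 = real n / 2 * (real n / 2) * (real n / 2)"
      by (simp add: power3_eq_cube)
    also have "\<dots> \<le> norm (r + of_nat n - r1) * norm (r + of_nat n - r2) * norm (r + of_nat n - r3)"
      using elim by (intro mult_mono) auto
    finally show ?case by (simp add: norm_mult)
  qed
qed

lemma fps_conv_radius_frob:
  fixes R :: real
  assumes "ereal R \<le> fps_conv_radius A" "ereal R \<le> fps_conv_radius B" "ereal R \<le> fps_conv_radius C"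
    and rec: "\<And>n. n > 0 \<Longrightarrow> (r + of_nat n - r1) * (r + of_nat n - r2) * (r + of_nat n - r3) * d n
               = - (\<Sum>k<n. frob_weight A B C r (n - k) k * d k)"
  shows "ereal R \<le> fps_conv_radius (Abs_fps d)"
proof -
  have "ereal R \<le> conv_radius d"
  proof (rule conv_radius_geI_ex')
    fix s :: real assume s: "0 < s" "ereal s < ereal R"
    \<comment> \<open>Two radii with s < t < rho < R: Cauchy estimates for the coefficients hold at
      rho, the recurrence then bounds d_n t^n, and Abel's lemma gives convergence at s.\<close>
    define t where "t = s + (R - s) / 3"
    define \<rho> where "\<rho> = s + 2 * (R - s) / 3"
    have ord: "s < t" "t < \<rho>" "\<rho> < R" using s by (auto simp: t_def \<rho>_def field_simps)
    have "ereal \<rho> < ereal R" using ord by simp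
    hence \<rho>: "ereal \<rho> < fps_conv_radius A" "ereal \<rho> < fps_conv_radius B" "ereal \<rho> < fps_conv_radius C"
      using assms(1-3) by (metis less_le_trans)+
    obtain M where M: "M \<ge> 0" "\<And>j k n. k < n \<Longrightarrow> norm r + 1 \<le> real n \<Longrightarrow>
           norm (frob_weight A B C r j k) * \<rho> ^ j \<le> M * real n ^ 2"
      using frob_weight_bound [OF \<rho>] s ord by (metis less_trans)
    have "eventually (\<lambda>n. norm r + 1 \<le> real n) sequentially" by real_asymp
    hence w: "eventually (\<lambda>n. \<forall>k<n. \<forall>j. norm (frob_weight A B C r j k) * \<rho> ^ j \<le> M * real n ^ 2) sequentially"
      by eventually_elim (use M(2) in blast)
    obtain B where "\<And>n. norm (d n) * t ^ n \<le> B"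
      using frob_recurrence_bounded [OF rec cubic_eventually_ge _ w M(1), of t] s ord by auto
    hence "summable (\<lambda>n. norm (d n) * s ^ n)"
      using s ord by (intro Abel_lemma [of s t]) auto
    hence "summable (\<lambda>n. norm (d n * of_real s ^ n))"
      using s by (simp add: norm_mult norm_power)
    thus "summable (\<lambda>n. d n * of_real s ^ n)" by (rule summable_norm_cancel)
  qed
  thus ?thesis by (simp add: fps_conv_radius_def)
qed

section \<open>From formal solutions to solutions on branches\<close>

lemma fps_conv_radius_pow_deriv:
  assumes "ereal R \<le> fps_conv_radius F"
  shows "ereal R \<le> fps_conv_radius (fps_pow_deriv s F)"
  unfolding fps_pow_deriv_def
  using order_trans [OF assms fps_conv_radius_deriv] assms
  by (intro fps_conv_radius_add_ge fps_conv_radius_mult_ge) auto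

text \<open>Differentiate exp (l z) = z by the chain rule.\<close>

lemma log_branch_deriv:
  assumes "log_branch_in R U l" "z \<in> U"
  shows "(l has_field_derivative 1 / z) (at z)"
proof -
  from assms have U: "open U" "l holomorphic_on U" "\<And>z. z \<in> U \<Longrightarrow> exp (l z) = z" "z \<noteq> 0"
    by (auto simp: log_branch_in_def)
  obtain D where D: "(l has_field_derivative D) (at z)"
    using U(1,2) assms(2) by (meson analytic_on_open analytic_on_imp_differentiable_at field_differentiable_def)
  have "((\<lambda>z. exp (l z)) has_field_derivative exp (l z) * D) (at z)"
    by (auto intro!: derivative_eq_intros D)
  hence "((\<lambda>z. z) has_field_derivative z * D) (at z)"
    using U assms(2) by (auto intro: has_field_derivative_transform_within_open)
  hence "z * D = 1" using DERIV_ident DERIV_unique by blast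
  hence "D = 1 / z" using U(4) assms(2) by (simp add: field_simps)
  thus ?thesis using D by simp
qed

text \<open>The derivative is again a branch power times a power series, with the exponent lowered
  by one, so the rule can be iterated.\<close>

lemma frob_branch_deriv:
  assumes U: "log_branch_in R U l" and z: "z \<in> U" and F: "ereal R \<le> fps_conv_radius F"
  shows "((\<lambda>z. exp (s * l z) * eval_fps F z) has_field_derivative
           exp ((s - 1) * l z) * eval_fps (fps_pow_deriv s F) z) (at z)"
proof -
  from U z have z': "norm z < R" "z \<noteq> 0" "exp (l z) = z" by (auto simp: log_branch_in_def)
  have rad: "ereal (norm z) < fps_conv_radius F" "ereal (norm z) < fps_conv_radius (fps_deriv F)"
    using z' F fps_conv_radius_deriv [of F] by (meson ereal_less_eq(3) less_ereal.simps(1) less_le_trans)+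
  have rad': "ereal (norm z) < fps_conv_radius (fps_const s * F)"
    "ereal (norm z) < fps_conv_radius (fps_X * fps_deriv F)"
    using rad by (auto intro!: less_le_trans [OF _ fps_conv_radius_mult])
  have "exp (s * l z) = exp ((s - 1) * l z) * exp (l z)"
    by (simp flip: exp_add add: algebra_simps)
  hence e: "exp (s * l z) = exp ((s - 1) * l z) * z" by (simp add: z')
  have "eval_fps (fps_pow_deriv s F) z = s * eval_fps F z + z * eval_fps (fps_deriv F) z"
    unfolding fps_pow_deriv_def using rad rad' by (simp add: eval_fps_add eval_fps_mult)
  thus ?thesis
    using z' by (auto intro!: derivative_eq_intros log_branch_deriv [OF U z]
        has_field_derivative_eval_fps rad simp: e field_simps)
qed

text \<open>The formula for \<open>f\<close> is assumed on \<open>U\<close> only, so that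
  \<open>f\<close> may itself be a derivative already computed there.\<close>

lemma frob_branch_deriv_on:
  assumes U: "log_branch_in R U l" and F: "ereal R \<le> fps_conv_radius F"
    and f: "\<And>z. z \<in> U \<Longrightarrow> f z = exp (s * l z) * eval_fps F z" and z: "z \<in> U"
  shows "deriv f z = exp ((s - 1) * l z) * eval_fps (fps_pow_deriv s F) z"
proof (rule DERIV_imp_deriv)
  have "open U" using U by (simp add: log_branch_in_def)
  thus "(f has_field_derivative exp ((s - 1) * l z) * eval_fps (fps_pow_deriv s F) z) (at z)"
    by (rule has_field_derivative_transform_within_open [OF frob_branch_deriv [OF U z F]])
      (use z f in auto)
qed

lemma solves_euler_on_frob_fun:
  assumes U: "log_branch_in R U l"
    and abc: "a holomorphic_on ball 0 R" "b holomorphic_on ball 0 R" "c holomorphic_on ball 0 R"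
    and d: "ereal R \<le> fps_conv_radius (Abs_fps d)"
    and eq: "fps_euler_op a b c r (Abs_fps d) = 0"
  shows "solves_euler_on a b c U (frob_fun l r d)"
proof -
  define F where "F = Abs_fps d"
  define F1 F2 F3 where "F1 = fps_pow_deriv r F" and "F2 = fps_pow_deriv (r - 1) F1"
    and "F3 = fps_pow_deriv (r - 2) F2"
  define A B C where "A = fps_expansion a 0" and "B = fps_expansion b 0" and "C = fps_expansion c 0"
  have rF: "ereal R \<le> fps_conv_radius F" "ereal R \<le> fps_conv_radius F1"
      "ereal R \<le> fps_conv_radius F2" "ereal R \<le> fps_conv_radius F3"
    using d by (simp_all add: F_def F1_def F2_def F3_def fps_conv_radius_pow_deriv)
  have abc': "a holomorphic_on eball 0 (ereal R)" "b holomorphic_on eball 0 (ereal R)"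
      "c holomorphic_on eball 0 (ereal R)"
    using abc by simp_all
  have rA: "ereal R \<le> fps_conv_radius A" "ereal R \<le> fps_conv_radius B" "ereal R \<le> fps_conv_radius C"
    using abc' by (simp_all add: A_def B_def C_def conv_radius_fps_expansion)
  define u where "u = frob_fun l r d"
  have u0: "u z = exp (r * l z) * eval_fps F z" for z
    by (simp add: u_def frob_fun_def F_def eval_fps_def)
  have u1: "deriv u z = exp ((r - 1) * l z) * eval_fps F1 z" if "z \<in> U" for z
    unfolding F1_def by (rule frob_branch_deriv_on [OF U rF(1) u0 that])
  have u2: "deriv (deriv u) z = exp ((r - 2) * l z) * eval_fps F2 z" if "z \<in> U" for z
    using frob_branch_deriv_on [OF U rF(2) u1 that] by (simp add: F2_def)
  have u3: "deriv (deriv (deriv u)) z = exp ((r - 3) * l z) * eval_fps F3 z" if "z \<in> U" for z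
    using frob_branch_deriv_on [OF U rF(3) u2 that] by (simp add: F3_def)
  have "euler_op a b c u z = 0" if z: "z \<in> U" for z
  proof -
    have z': "norm z < R" "exp (l z) = z" using U z by (auto simp: log_branch_in_def)
    have less: "ereal (norm z) < x" if "ereal R \<le> x" for x
      using that z' by (meson less_ereal.simps(1) less_le_trans)
    have z1: "z * exp ((s - 1) * l z) = exp (s * l z)" for s
      using exp_add [of "l z" "(s - 1) * l z"] z'(2) by (simp add: algebra_simps)
    \<comment> \<open>The lowest power that occurs. Writing the others as powers of z times
      \<open>E\<close> leaves a plain ring identity.\<close>
    define E where "E = exp ((r - 3) * l z)"
    have e: "exp (r * l z) = z * (z * (z * E))" "exp ((r - 1) * l z) = z * (z * E)"
      "exp ((r - 2) * l z) = z * E"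
      using z1 [of r] z1 [of "r - 1"] z1 [of "r - 2"] by (simp_all add: E_def)
    have "0 = eval_fps (F3 + A * F2 + B * F1 + C * F) z"
      using eq by (simp add: fps_euler_op_def F_def F1_def F2_def F3_def A_def B_def C_def)
    also have "\<dots> = eval_fps F3 z + eval_fps A z * eval_fps F2 z
        + eval_fps B z * eval_fps F1 z + eval_fps C z * eval_fps F z"
      using rF rA by (simp add: eval_fps_add eval_fps_mult less fps_conv_radius_add_ge fps_conv_radius_mult_ge)
    also have "eval_fps A z = a z"
      unfolding A_def by (subst eval_fps_expansion' [OF abc'(1)]) (use z' in auto)
    also have "eval_fps B z = b z"
      unfolding B_def by (subst eval_fps_expansion' [OF abc'(2)]) (use z' in auto)
    also have "eval_fps C z = c z"
      unfolding C_def by (subst eval_fps_expansion' [OF abc'(3)]) (use z' in auto)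
    finally have 0: "eval_fps F3 z + a z * eval_fps F2 z + b z * eval_fps F1 z + c z * eval_fps F z = 0"
      by simp
    have "euler_op a b c u z = exp (r * l z) *
        (eval_fps F3 z + a z * eval_fps F2 z + b z * eval_fps F1 z + c z * eval_fps F z)"
      by (simp add: euler_op_def numeral_2_eq_2 numeral_3_eq_3 u0 u1 u2 u3 z e E_def [symmetric])
         (simp add: algebra_simps)
    thus ?thesis by (simp add: 0)
  qed
  moreover have "u holomorphic_on U"
    using frob_branch_deriv [OF U _ rF(1), of _ r] U unfolding u0 [abs_def]
    by (auto simp: log_branch_in_def intro!: holomorphic_on_open [THEN iffD2])
  ultimately show ?thesis by (simp add: solves_euler_on_def u_def)
qed

text \<open>Serves all three exponents: \<open>nonres\<close> says that the recurrence never divides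
  by zero.\<close>

lemma frob_solution_exists:
  fixes R :: real
  assumes abc: "a holomorphic_on ball 0 R" "b holomorphic_on ball 0 R" "c holomorphic_on ball 0 R"
    and roots: "proots (indicial_poly a b c) = {#r1, r2, r3#}"
    and r: "r \<in> {r1, r2, r3}"
    and nonres: "\<And>n::nat. n > 0 \<Longrightarrow> r + of_nat n \<notin> {r1, r2, r3}"
  obtains d where "frob_solution R a b c r d" "obtained_by_substitution a b c r d"
proof -
  define Q where "Q = (\<lambda>n. poly (indicial_poly a b c) (r + of_nat n))"
  define d where "d = frob_coeff Q (euler_weight a b c r)"
  have Q: "Q n = (r + of_nat n - r1) * (r + of_nat n - r2) * (r + of_nat n - r3)" for n
    unfolding Q_def by (rule indicial_poly_factor [OF roots])
  have Q0: "Q 0 = 0" "\<And>n. n > 0 \<Longrightarrow> Q n \<noteq> 0"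
    using r nonres by (auto simp: Q)
  have uniq: "e 0 = 1 \<and> fps_euler_op a b c r (Abs_fps e) = 0 \<longleftrightarrow> e = d" for e
    using frob_coeff_unique [of Q e "euler_weight a b c r"]
      Q0 by (simp add: fps_eq_iff fps_euler_op_nth d_def Q_def)
  hence sub: "obtained_by_substitution a b c r d"
    by (simp add: obtained_by_substitution_def)
  have d: "d 0 = 1" "fps_euler_op a b c r (Abs_fps d) = 0" using uniq [of d] by auto
  have rec: "Q n * d n = - (\<Sum>k<n. euler_weight a b c r (n - k) k * d k)" for n
    using arg_cong [OF d(2), of "\<lambda>F. F $ n"]
    by (simp add: fps_euler_op_nth Q_def eq_neg_iff_add_eq_0)
  have rad: "ereal R \<le> fps_conv_radius (Abs_fps d)"
    by (rule fps_conv_radius_frob [OF _ _ _ rec [unfolded Q]])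
       (use abc in \<open>auto intro: conv_radius_fps_expansion\<close>)
  have "summable (\<lambda>n. d n * z ^ n)" if "z \<in> ball 0 R" for z
    using summable_fps [of z "Abs_fps d"] less_le_trans [OF _ rad, of "ereal (norm z)"] that by simp
  hence "frob_solution R a b c r d"
    using d rad abc by (simp add: frob_solution_def solves_euler_on_frob_fun)
  thus thesis using sub that by blast
qed

section \<open>Linear independence by monodromy\<close>

text \<open>Combining the equations with the coefficients of (T - q)(T - s) eliminates
  \<open>y\<close> and \<open>z\<close>.\<close>

lemma vandermonde3_zero:
  fixes x y z :: complex
  assumes "x + y + z = 0" "p * x + q * y + s * z = 0" "p\<^sup>2 * x + q\<^sup>2 * y + s\<^sup>2 * z = 0"
    and "p \<noteq> q" "p \<noteq> s"
  shows "x = 0"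
proof -
  have "(p - q) * (p - s) * x = (p\<^sup>2 * x + q\<^sup>2 * y + s\<^sup>2 * z)
      - (q + s) * (p * x + q * y + s * z) + q * s * (x + y + z)"
    by (simp add: power2_eq_square algebra_simps)
  thus ?thesis using assms by simp
qed

lemma exp_2pi_i_neq:
  assumes "r - s \<notin> \<int>"
  shows "exp (2 * pi * \<i> * r) \<noteq> exp (2 * pi * \<i> * s)"
proof
  assume "exp (2 * pi * \<i> * r) = exp (2 * pi * \<i> * s)"
  then obtain n :: int where "2 * pi * \<i> * r = 2 * pi * \<i> * s + (of_int (2 * n) * pi) * \<i>"
    by (auto simp: exp_eq)
  hence "2 * pi * \<i> * (r - s) = 2 * pi * \<i> * of_int n" by (simp add: algebra_simps)
  hence "r - s = of_int n" by simp
  thus False using assms by simp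
qed

text \<open>In the variable \<open>w = log z\<close> a linear relation extends to a whole half plane, where translation by
  \<open>2 \<pi> \<i>\<close> multiplies the three summands by the distinct numbers \<open>exp (2 \<pi> \<i> r\<^sub>j)\<close>.\<close>
lemma frob_funs_lin_indep:
  assumes U: "log_branch_in R U l" "U \<noteq> {}"
    and d: "d 0 = 1" "d' 0 = 1" "d'' 0 = 1"
    and sm: "\<And>z. z \<in> ball 0 R \<Longrightarrow> summable (\<lambda>n. d n * z ^ n)"
      "\<And>z. z \<in> ball 0 R \<Longrightarrow> summable (\<lambda>n. d' n * z ^ n)"
      "\<And>z. z \<in> ball 0 R \<Longrightarrow> summable (\<lambda>n. d'' n * z ^ n)"
    and nz: "r1 - r2 \<notin> \<int>" "r1 - r3 \<notin> \<int>" "r2 - r3 \<notin> \<int>"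
  shows "lin_indep3_on U (frob_fun l r1 d) (frob_fun l r2 d') (frob_fun l r3 d'')"
  unfolding lin_indep3_on_def
proof (intro allI impI)
  fix \<alpha> \<beta> \<gamma> :: complex
  assume rel: "\<forall>z\<in>U. \<alpha> * frob_fun l r1 d z + \<beta> * frob_fun l r2 d' z + \<gamma> * frob_fun l r3 d'' z = 0"
  from U have U': "open U" "U \<subseteq> ball 0 R - {0}" "l holomorphic_on U" "\<And>z. z \<in> U \<Longrightarrow> exp (l z) = z"
    by (auto simp: log_branch_in_def)
  then obtain z0 where "z0 \<in> U" "norm z0 < R" using U(2) by fastforce
  hence R: "R > 0" using norm_ge_zero [of z0] by linarith
  \<comment> \<open>The preimage under exp of the punctured disc. On it \<open>g\<close> below is a
    single-valued lift of z^r F.\<close>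
  define H where "H = {w. Re w < ln R}"
  have H: "open H" "connected H" unfolding H_def
    by (auto intro: open_halfspace_Re_lt convex_connected convex_halfspace_Re_lt)
  have expH: "norm (exp w) < R \<longleftrightarrow> w \<in> H" for w
    using R ln_less_cancel_iff [of "exp (Re w)" R] by (simp add: H_def)
  have exp_into: "exp ` H \<subseteq> ball 0 R" using expH by auto
  define g where "g = (\<lambda>r e w. exp (r * w) * eval_fps (Abs_fps e) (exp w) :: complex)"
  have rad: "ereal R \<le> fps_conv_radius (Abs_fps e)"
    if "\<And>z. z \<in> ball 0 R \<Longrightarrow> summable (\<lambda>n. e n * z ^ n)" for e :: "nat \<Rightarrow> complex"
    unfolding fps_conv_radius_def by (rule conv_radius_geI_ex') (use that in auto)
  have hol: "g r e holomorphic_on H" if "ereal R \<le> fps_conv_radius (Abs_fps e)" for r e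
  proof -
    have "eval_fps (Abs_fps e) holomorphic_on ball 0 R"
      using less_le_trans [OF _ that] by (intro holomorphic_on_eval_fps) (auto simp: in_eball_iff)
    hence "(\<lambda>w. eval_fps (Abs_fps e) (exp w)) holomorphic_on H"
      using holomorphic_on_compose_gen [OF holomorphic_on_exp _ exp_into, unfolded o_def] by blast
    thus ?thesis unfolding g_def by (intro holomorphic_intros)
  qed
  have inj: "inj_on l U" by (rule inj_on_inverseI [of _ exp]) (rule U'(4))
  have lU: "open (l ` U)" by (rule open_mapping_thm3 [OF U'(3,1) inj])
  have sub: "l ` U \<subseteq> H" using U' expH by fastforce
  have zero: "\<alpha> * g r1 d w + \<beta> * g r2 d' w + \<gamma> * g r3 d'' w = 0" if "w \<in> H" for w
  proof (rule analytic_continuation_open [OF lU H(1) _ H(2) sub _ _ _ that, where g = "\<lambda>_. 0"])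
    show "(\<lambda>w. \<alpha> * g r1 d w + \<beta> * g r2 d' w + \<gamma> * g r3 d'' w) holomorphic_on H"
      using sm by (intro holomorphic_intros hol rad)
    fix w assume "w \<in> l ` U"
    then obtain z where "z \<in> U" "w = l z" by blast
    thus "\<alpha> * g r1 d w + \<beta> * g r2 d' w + \<gamma> * g r3 d'' w = 0"
      using rel U'(4) by (auto simp: g_def frob_fun_def eval_fps_def)
  qed (use U in auto)
  define \<mu> where "\<mu> = (\<lambda>r::complex. exp (2 * pi * \<i> * r))"
  have per: "g r e (w + 2 * pi * \<i>) = \<mu> r * g r e w" for r e w
    by (simp add: g_def \<mu>_def ring_distribs exp_add mult_ac)
  have van: "\<alpha> * g r1 d w = 0" "\<beta> * g r2 d' w = 0" "\<gamma> * g r3 d'' w = 0" if w: "w \<in> H" for w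
  proof -
    \<comment> \<open>Turns change only the imaginary part, so the relation also holds at both
      translates.\<close>
    have "w + 2 * pi * \<i> \<in> H" "w + 2 * pi * \<i> + 2 * pi * \<i> \<in> H" using w by (auto simp: H_def)
    note zs = zero [OF w] this [THEN zero, unfolded per]
    have ne: "\<mu> r1 \<noteq> \<mu> r2" "\<mu> r1 \<noteq> \<mu> r3" "\<mu> r2 \<noteq> \<mu> r3"
      unfolding \<mu>_def by (rule nz [THEN exp_2pi_i_neq])+
    show "\<alpha> * g r1 d w = 0"
      by (rule vandermonde3_zero [of _ "\<beta> * g r2 d' w" "\<gamma> * g r3 d'' w" "\<mu> r1" "\<mu> r2" "\<mu> r3"])
         (use zs ne in \<open>auto simp: power2_eq_square algebra_simps\<close>)
    show "\<beta> * g r2 d' w = 0"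
      by (rule vandermonde3_zero [of _ "\<alpha> * g r1 d w" "\<gamma> * g r3 d'' w" "\<mu> r2" "\<mu> r1" "\<mu> r3"])
         (use zs ne in \<open>auto simp: power2_eq_square algebra_simps\<close>)
    show "\<gamma> * g r3 d'' w = 0"
      by (rule vandermonde3_zero [of _ "\<alpha> * g r1 d w" "\<beta> * g r2 d' w" "\<mu> r3" "\<mu> r1" "\<mu> r2"])
         (use zs ne in \<open>auto simp: power2_eq_square algebra_simps\<close>)
  qed
  \<comment> \<open>Near z = 0 the series is close to its constant term 1; a small positive real
    \<open>x\<close> with logarithm in \<open>H\<close> is a witness.\<close>
  have nonzero: "\<exists>w\<in>H. g r e w \<noteq> 0"
    if e: "e 0 = 1" and "ereal R \<le> fps_conv_radius (Abs_fps e)" for r e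
  proof -
    have "isCont (eval_fps (Abs_fps e)) 0"
      using has_field_derivative_eval_fps [of 0 "Abs_fps e" UNIV] less_le_trans [OF _ that(2), of 0] R
      by (auto intro: DERIV_isCont simp: zero_ereal_def)
    moreover have "eval_fps (Abs_fps e) 0 \<noteq> 0" by (simp add: eval_fps_at_0 e)
    ultimately obtain \<epsilon> where \<epsilon>: "\<epsilon> > 0" "\<And>y. dist 0 y < \<epsilon> \<Longrightarrow> eval_fps (Abs_fps e) y \<noteq> 0"
      using continuous_at_avoid by blast
    define x where "x = min R \<epsilon> / 2"
    have x: "0 < x" "x < R" "x < \<epsilon>" using R \<epsilon>(1) by (auto simp: x_def)
    have ex: "exp (complex_of_real (ln x)) = of_real x"
      using x by (metis exp_ln exp_of_real)
    have "complex_of_real (ln x) \<in> H" using x R by (simp add: H_def)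
    moreover have "g r e (of_real (ln x)) \<noteq> 0" using \<epsilon>(2) [of "of_real x"] x by (simp add: g_def ex)
    ultimately show ?thesis by blast
  qed
  show "\<alpha> = 0 \<and> \<beta> = 0 \<and> \<gamma> = 0"
    using nonzero [OF d(1) rad [OF sm(1)], of r1] nonzero [OF d(2) rad [OF sm(2)], of r2]
      nonzero [OF d(3) rad [OF sm(3)], of r3] van by (metis mult_eq_0_iff)
qed

section \<open>Exponent differences and conclusion\<close>

text \<open>The ordering of real parts rules out negative integers; the monodromy factors are
  distinct only if all integers are excluded.\<close>

lemma diff_not_Ints:
  fixes r s :: complex
  assumes "r - s \<notin> \<nat>" "Re r \<ge> Re s"
  shows "r - s \<notin> \<int>"
proof
  assume "r - s \<in> \<int>"
  then obtain n where n: "r - s = of_int n" by (auto elim: Ints_cases)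
  have "real_of_int n \<ge> 0" using arg_cong [OF n, of Re] assms(2) by simp
  hence "r - s = of_nat (nat n)" by (simp add: n)
  thus False using assms(1) by simp
qed

text \<open>The two alternatives cover roots to the right of \<open>r\<close>, excluded by
  hypothesis, and roots not to the right of it, which r+n has already passed.\<close>

lemma add_of_nat_neq:
  fixes r s :: complex
  assumes "s - r \<notin> \<nat> \<or> Re r \<ge> Re s" "n > 0"
  shows "r + of_nat n \<noteq> s"
  using assms by (auto simp: algebra_simps)

theorem theorem7:
  fixes R :: real and a b c :: "complex \<Rightarrow> complex" and r1 r2 r3 :: complex
  assumes "R > 0"
    and "a holomorphic_on ball 0 R" and "b holomorphic_on ball 0 R" and "c holomorphic_on ball 0 R"
    and "proots (indicial_poly a b c) = {#r1, r2, r3#}"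
    and "Re r1 \<ge> Re r2" and "Re r2 \<ge> Re r3"
  shows "\<exists>d. frob_solution R a b c r1 d \<and> obtained_by_substitution a b c r1 d \<and>
    (r1 - r2 \<notin> \<nat> \<and> r1 - r3 \<notin> \<nat> \<and> r2 - r3 \<notin> \<nat> \<longrightarrow>
      (\<exists>d' d''.
        frob_solution R a b c r2 d' \<and> obtained_by_substitution a b c r2 d' \<and>
        frob_solution R a b c r3 d'' \<and> obtained_by_substitution a b c r3 d'' \<and>
        (\<forall>U l. log_branch_in R U l \<and> U \<noteq> {} \<longrightarrow>
          lin_indep3_on U (frob_fun l r1 d) (frob_fun l r2 d') (frob_fun l r3 d''))))"
proof -
  note exists = frob_solution_exists [OF assms(2-5)]
  obtain d where d: "frob_solution R a b c r1 d" "obtained_by_substitution a b c r1 d"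
    by (rule exists [of r1]) (use assms add_of_nat_neq in auto)
  have "\<exists>d' d''. frob_solution R a b c r2 d' \<and> obtained_by_substitution a b c r2 d' \<and>
        frob_solution R a b c r3 d'' \<and> obtained_by_substitution a b c r3 d'' \<and>
        (\<forall>U l. log_branch_in R U l \<and> U \<noteq> {} \<longrightarrow>
          lin_indep3_on U (frob_fun l r1 d) (frob_fun l r2 d') (frob_fun l r3 d''))"
    if N: "r1 - r2 \<notin> \<nat>" "r1 - r3 \<notin> \<nat>" "r2 - r3 \<notin> \<nat>"
  proof -
    obtain d' where d': "frob_solution R a b c r2 d'" "obtained_by_substitution a b c r2 d'"
      by (rule exists [of r2]) (use assms N add_of_nat_neq in auto)
    obtain d'' where d'': "frob_solution R a b c r3 d''" "obtained_by_substitution a b c r3 d''"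
      by (rule exists [of r3]) (use assms N add_of_nat_neq in auto)
    have "r1 - r2 \<notin> \<int>" "r1 - r3 \<notin> \<int>" "r2 - r3 \<notin> \<int>"
      using diff_not_Ints [OF N(1) assms(6)] diff_not_Ints [OF N(2) order_trans [OF assms(7,6)]]
        diff_not_Ints [OF N(3) assms(7)] by blast+
    hence "lin_indep3_on U (frob_fun l r1 d) (frob_fun l r2 d') (frob_fun l r3 d'')"
      if "log_branch_in R U l" "U \<noteq> {}" for U l
      using that d d' d'' by (intro frob_funs_lin_indep) (auto simp: frob_solution_def)
    thus ?thesis using d' d'' by blast
  qed
  thus ?thesis using d by blast
qed

end
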